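(* For $n\geq 3$, $\mathrm{rank}(\mathsf{R}_{1})=\mathrm{rank}(\mathsf{R}_{n})=2n-4$.
   Context: For a positive integer $n$, let $X_n=\{1<2<\cdots<n\}$ and let $\mathcal{O}_n$ be the semigroup of all order-preserving maps $\alpha: X_n\to X_n$ (i.e. $x<y$ implies $x\alpha\leq y\alpha$) under composition. Maps are written on the right and composed left to right: $x(\alpha\beta)=(x\alpha)\beta$. For $1\leq k\leq n$, $\pi_k\in\mathcal{O}_n$ is the constant map $x\pi_k=k$ for all $x\in X_n$, and $$\mathsf{R}_{k} = \{ \alpha \in \mathcal{O}_{n} : \gamma \alpha =\pi_{k} \text{ for some } \gamma \in \mathcal{O}_{n}\setminus\{\pi_k\} \}.$$ The sets $\mathsf{R}_1$ and $\mathsf{R}_n$ are subsemigroups of $\mathcal{O}_n$. For a semigroup $S$, $\langle A\rangle$ denotes the smallest subsemigroup of $S$ containing the non-empty subset $A$, and $\mathrm{rank}(S)=\min\{\lvert A\rvert : S=\langle A\rangle\}$. *)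

theory Defs
  imports Main "HOL-Library.FuncSet"
begin

(* A map X_n -> X_n is a function on nat that is undefined outside {1..n},
   so that equality of functions is equality of maps. *)
definition order_preserving_maps :: "nat \<Rightarrow> (nat \<Rightarrow> nat) set" where
  "order_preserving_maps n = {\<alpha> \<in> {1..n} \<rightarrow>\<^sub>E {1..n}. mono_on {1..n} \<alpha>}"

(* Maps act on the right: x (alpha beta) = (x alpha) beta, the reverse of the
   argument order of compose. *)
definition map_mult :: "nat \<Rightarrow> (nat \<Rightarrow> nat) \<Rightarrow> (nat \<Rightarrow> nat) \<Rightarrow> nat \<Rightarrow> nat" where
  "map_mult n \<alpha> \<beta> = compose {1..n} \<beta> \<alpha>"

definition const_map :: "nat \<Rightarrow> nat \<Rightarrow> nat \<Rightarrow> nat" where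
  "const_map n k = (\<lambda>x\<in>{1..n}. k)"

definition R_set :: "nat \<Rightarrow> nat \<Rightarrow> (nat \<Rightarrow> nat) set" where
  "R_set n k = {\<alpha> \<in> order_preserving_maps n.
     \<exists>\<gamma> \<in> order_preserving_maps n - {const_map n k}. map_mult n \<gamma> \<alpha> = const_map n k}"

definition subsemigroup :: "('a \<Rightarrow> 'a \<Rightarrow> 'a) \<Rightarrow> 'a set \<Rightarrow> 'a set \<Rightarrow> bool" where
  "subsemigroup mult S T \<longleftrightarrow> T \<noteq> {} \<and> T \<subseteq> S \<and> (\<forall>x\<in>T. \<forall>y\<in>T. mult x y \<in> T)"

definition generated_subsemigroup :: "('a \<Rightarrow> 'a \<Rightarrow> 'a) \<Rightarrow> 'a set \<Rightarrow> 'a set \<Rightarrow> 'a set" where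
  "generated_subsemigroup mult S A = \<Inter>{T. subsemigroup mult S T \<and> A \<subseteq> T}"

(* Meaningful for finitely generated S only: without a finite generating set
   the infimum of the empty set of naturals is 0. *)
definition semigroup_rank :: "('a \<Rightarrow> 'a \<Rightarrow> 'a) \<Rightarrow> 'a set \<Rightarrow> nat" where
  "semigroup_rank mult S =
     Inf {card A | A. A \<noteq> {} \<and> finite A \<and> A \<subseteq> S \<and> generated_subsemigroup mult S A = S}"

end

theory Submission
  imports Defs
begin

text \<open>Some \<open>\<gamma> \<noteq> \<pi>\<^sub>1\<close> satisfies \<open>\<gamma>\<alpha> =
\<pi>\<^sub>1\<close> exactly when \<open>\<alpha>\<close> sends a point above 1 to 1, so \<open>R\<^sub>1\<close>
consists of the order-preserving maps with \<open>1\<alpha> = 2\<alpha> = 1\<close> (lemma \<open>R_set_one\<close>).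
Products are read from left to right throughout.

For the lower bound, consider a product \<open>\<beta>\<gamma>\<close> in \<open>R\<^sub>1\<close> that does not send
3 to 1. Then \<open>3\<beta> \<ge> 3\<close>, because \<open>\<gamma>\<close> collapses 1 and 2. If moreover
\<open>\<beta>\<close> is injective on \<open>{3..n}\<close>, it has no room to move anything there: it fixes all
points from 3 on and is the left identity of \<open>R\<^sub>1\<close>. This makes several subsets of
\<open>R\<^sub>1\<close> prime, in the sense that a product in the subset has a factor in it: each of the \<open>n -
1\<close> maps of rank \<open>n - 1\<close>, taken as a singleton, and, for each \<open>j\<close> with \<open>3 \<le>
j < n\<close>, the set of maps whose only coincidence between neighbours, besides that of 1 and 2, is between
\<open>j\<close> and \<open>j + 1\<close>. The complement of a prime set is closed under products, so a generating set
meets each of these \<open>(n - 1) + (n - 3)\<close> disjoint sets.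

For the upper bound, one map from each of the sets suffices, if the representative for \<open>j\<close> is the one
that sends \<open>j\<close> up to \<open>j + 1\<close> and fixes all other points from 3 on. Let
\<open>\<alpha>\<close> be in \<open>R\<^sub>1\<close>. If \<open>\<alpha>\<close> rises before some \<open>j\<close>
and is constant on \<open>{j, j + 1}\<close>, then that representative, followed by \<open>\<alpha>\<close> with its
value at \<open>j\<close> lowered to the preceding one, is \<open>\<alpha>\<close>; the sum of the values drops (lemma
\<open>raise_map_factorization\<close>). If there is no such \<open>j\<close>, then \<open>\<alpha>\<close> is 1 up to
some \<open>m\<close> and strictly increasing from there on. It then factors as a map of rank \<open>n - 1\<close>
followed by a map of the same form with \<open>m - 1\<close> in place of \<open>m\<close>, which is the identity once
\<open>m - 1 = 1\<close> (lemma \<open>lower_map_factorization\<close>).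

Reversing the chain is an isomorphism from \<open>R\<^sub>1\<close> to \<open>R\<^sub>n\<close>, which settles the
second rank.\<close>

section \<open>Generating sets and rank of an abstract semigroup\<close>

text \<open>If no subsemigroup contains \<open>A\<close>, the intersection that defines the generated subsemigroup is
the whole type. As \<open>S\<close> is closed and \<open>A\<close> is a nonempty part of it, \<open>S\<close> itself
is such a subsemigroup, and the intersection is the intended one.\<close>

lemma generates_iff:
  assumes closed: "\<And>x y. x \<in> S \<Longrightarrow> y \<in> S \<Longrightarrow> mult x y \<in> S"
    and A: "A \<subseteq> S" "A \<noteq> {}"
  shows "generated_subsemigroup mult S A = S
    \<longleftrightarrow> (\<forall>T. subsemigroup mult S T \<and> A \<subseteq> T \<longrightarrow> T = S)"
proof -
  have S: "subsemigroup mult S S"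
    using closed A by (auto simp: subsemigroup_def)
  have sub: "T \<subseteq> S" if "subsemigroup mult S T" for T
    using that by (simp add: subsemigroup_def)
  show ?thesis
    unfolding generated_subsemigroup_def using S sub A by blast
qed

text \<open>A generating set that missed \<open>P\<close> would lie in the complement of \<open>P\<close>, which is a
subsemigroup as \<open>P\<close> is prime, and a proper one as \<open>P\<close> meets \<open>S\<close>.\<close>

lemma generating_set_meets:
  assumes closed: "\<And>x y. x \<in> S \<Longrightarrow> y \<in> S \<Longrightarrow> mult x y \<in> S"
    and A: "A \<subseteq> S" "A \<noteq> {}" "generated_subsemigroup mult S A = S"
    and P: "P \<inter> S \<noteq> {}"
    and prime: "\<And>x y. x \<in> S \<Longrightarrow> y \<in> S \<Longrightarrow> mult x y \<in> P \<Longrightarrow> x \<in> P \<or> y \<in> P"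
  shows "A \<inter> P \<noteq> {}"
proof
  assume "A \<inter> P = {}"
  then have "A \<subseteq> S - P" using A by blast
  moreover have "subsemigroup mult S (S - P)"
    using closed prime A(2) \<open>A \<subseteq> S - P\<close> unfolding subsemigroup_def by blast
  ultimately have "S - P = S"
    using generates_iff[of S mult A] closed A by blast
  then show False using P by blast
qed

text \<open>Disjoint prime subsets are met by a generating set in different elements.\<close>

lemma card_generating_set_ge:
  assumes closed: "\<And>x y. x \<in> S \<Longrightarrow> y \<in> S \<Longrightarrow> mult x y \<in> S"
    and A: "A \<subseteq> S" "A \<noteq> {}" "generated_subsemigroup mult S A = S" "finite A"
    and P: "\<And>i. i \<in> I \<Longrightarrow> P i \<inter> S \<noteq> {}"
    and prime: "\<And>i x y. i \<in> I \<Longrightarrow> x \<in> S \<Longrightarrow> y \<in> S \<Longrightarrow> mult x y \<in> P i \<Longrightarrow> x \<in> P i \<or> y \<in> P i"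
    and disj: "\<And>i j. i \<in> I \<Longrightarrow> j \<in> I \<Longrightarrow> i \<noteq> j \<Longrightarrow> P i \<inter> P j = {}"
  shows "card I \<le> card A"
proof -
  have "\<exists>a. a \<in> A \<inter> P i" if "i \<in> I" for i
    using generating_set_meets[OF closed A(1-3) P[OF that] prime[OF that]] by blast
  then obtain h where h: "\<And>i. i \<in> I \<Longrightarrow> h i \<in> A \<inter> P i" by metis
  have "inj_on h I"
    using h disj by (intro inj_onI) (metis IntD2 disjoint_iff)
  then show ?thesis
    using h A(4) by (intro card_inj_on_le[of h]) auto
qed

lemma semigroup_rank_eqI:
  assumes "A \<noteq> {}" "finite A" "A \<subseteq> S" "generated_subsemigroup mult S A = S"
    and "card A \<le> r"
    and "\<And>B. B \<noteq> {} \<Longrightarrow> finite B \<Longrightarrow> B \<subseteq> S \<Longrightarrow> generated_subsemigroup mult S B = S \<Longrightarrow> r \<le> card B"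
  shows "semigroup_rank mult S = r"
proof -
  have "card A = r" using assms by (intro antisym) auto
  then show ?thesis
    unfolding semigroup_rank_def using assms by (intro cInf_eq_minimum) blast+
qed

lemma generating_set_image:
  assumes closed: "\<And>x y. x \<in> S \<Longrightarrow> y \<in> S \<Longrightarrow> mult x y \<in> S"
    and onto: "f ` S = S'"
    and hom: "\<And>x y. x \<in> S \<Longrightarrow> y \<in> S \<Longrightarrow> f (mult x y) = mult' (f x) (f y)"
    and A: "A \<subseteq> S" "A \<noteq> {}" "generated_subsemigroup mult S A = S"
  shows "generated_subsemigroup mult' S' (f ` A) = S'"
proof -
  have closed': "mult' x y \<in> S'" if "x \<in> S'" "y \<in> S'" for x y
  proof -
    from that onto obtain a b where "a \<in> S" "x = f a" "b \<in> S" "y = f b" by blast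
    then show ?thesis using imageI[OF closed, of a b f] hom[of a b] onto by simp
  qed
  have "T = S'" if T: "subsemigroup mult' S' T" "f ` A \<subseteq> T" for T
  proof -
    have sub: "A \<subseteq> {x \<in> S. f x \<in> T}" using A T by auto
    then have "{x \<in> S. f x \<in> T} \<noteq> {}" using A(2) by blast
    then have "subsemigroup mult S {x \<in> S. f x \<in> T}"
      using T closed hom unfolding subsemigroup_def by simp
    with sub have "{x \<in> S. f x \<in> T} = S"
      using generates_iff[of S mult A] closed A by blast
    then have "f ` S \<subseteq> T" by blast
    moreover have "T \<subseteq> S'" using T(1) by (simp add: subsemigroup_def)
    ultimately show "T = S'" using onto by blast
  qed
  moreover have "f ` A \<subseteq> S'" "f ` A \<noteq> {}" using A onto by blast+
  ultimately show ?thesis by (simp add: generates_iff[OF closed'])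
qed

lemma semigroup_rank_iso:
  assumes closed: "\<And>x y. x \<in> S \<Longrightarrow> y \<in> S \<Longrightarrow> mult x y \<in> S"
    and bij: "bij_betw f S S'"
    and hom: "\<And>x y. x \<in> S \<Longrightarrow> y \<in> S \<Longrightarrow> f (mult x y) = mult' (f x) (f y)"
  shows "semigroup_rank mult S = semigroup_rank mult' S'"
proof -
  define g where "g = inv_into S f"
  have bij': "bij_betw g S' S" unfolding g_def using bij by (rule bij_betw_inv_into)
  have gf: "g (f x) = x" if "x \<in> S" for x
    using that bij unfolding g_def by (simp add: bij_betw_inv_into_left)
  have fg: "f (g x) = x" if "x \<in> S'" for x
    using that bij unfolding g_def by (simp add: bij_betw_inv_into_right)
  have gS: "g x \<in> S" if "x \<in> S'" for x using bij' that by (meson bij_betwE)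
  have fS: "f x \<in> S'" if "x \<in> S" for x using bij that by (meson bij_betwE)
  have closed': "mult' x y \<in> S'" if "x \<in> S'" "y \<in> S'" for x y
    using fS[OF closed[OF gS[OF that(1)] gS[OF that(2)]]] hom[OF gS[OF that(1)] gS[OF that(2)]]
      fg[OF that(1)] fg[OF that(2)] by simp
  have hom': "g (mult' x y) = mult (g x) (g y)" if "x \<in> S'" "y \<in> S'" for x y
    using gf[OF closed[OF gS[OF that(1)] gS[OF that(2)]]] hom[OF gS[OF that(1)] gS[OF that(2)]]
      fg[OF that(1)] fg[OF that(2)] by simp
  have transfer: "\<exists>B. card A = card B \<and> B \<noteq> {} \<and> finite B \<and> B \<subseteq> S' \<and> generated_subsemigroup mult' S' B = S'"
    if "A \<noteq> {}" "finite A" "A \<subseteq> S" "generated_subsemigroup mult S A = S" for A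
  proof (intro exI conjI)
    show "card A = card (f ` A)"
      using card_image[OF inj_on_subset[OF bij_betw_imp_inj_on[OF bij] that(3)]] by simp
    show "generated_subsemigroup mult' S' (f ` A) = S'"
      using closed bij_betw_imp_surj_on[OF bij] hom that(3,1,4)
      by (rule generating_set_image[where S = S and mult = mult and mult' = mult'])
  qed (use that fS in auto)
  have transfer': "\<exists>B. card A = card B \<and> B \<noteq> {} \<and> finite B \<and> B \<subseteq> S \<and> generated_subsemigroup mult S B = S"
    if "A \<noteq> {}" "finite A" "A \<subseteq> S'" "generated_subsemigroup mult' S' A = S'" for A
  proof (intro exI conjI)
    show "card A = card (g ` A)"
      using card_image[OF inj_on_subset[OF bij_betw_imp_inj_on[OF bij'] that(3)]] by simp
    show "generated_subsemigroup mult S (g ` A) = S"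
      using closed' bij_betw_imp_surj_on[OF bij'] hom' that(3,1,4)
      by (rule generating_set_image[where S = S' and mult = mult' and mult' = mult])
  qed (use that gS in auto)
  have "{card A | A. A \<noteq> {} \<and> finite A \<and> A \<subseteq> S \<and> generated_subsemigroup mult S A = S}
      = {card A | A. A \<noteq> {} \<and> finite A \<and> A \<subseteq> S' \<and> generated_subsemigroup mult' S' A = S'}"
    using transfer transfer' by (intro equalityI subsetI; elim CollectE exE conjE; simp)
  then show ?thesis unfolding semigroup_rank_def by simp
qed

section \<open>Order-preserving maps\<close>

lemma map_mult_apply: "x \<in> {1..n} \<Longrightarrow> map_mult n \<alpha> \<beta> x = \<beta> (\<alpha> x)"
  by (simp add: map_mult_def compose_def)

lemma order_preserving_range:
  "\<alpha> \<in> order_preserving_maps n \<Longrightarrow> x \<in> {1..n} \<Longrightarrow> \<alpha> x \<in> {1..n}"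
  unfolding order_preserving_maps_def by blast

lemma order_preserving_mono:
  "\<alpha> \<in> order_preserving_maps n \<Longrightarrow> 1 \<le> x \<Longrightarrow> x \<le> y \<Longrightarrow> y \<le> n \<Longrightarrow> \<alpha> x \<le> \<alpha> y"
  unfolding order_preserving_maps_def by (auto simp: mono_on_def)

lemma order_preserving_eqI:
  assumes "\<alpha> \<in> order_preserving_maps n" "\<beta> \<in> order_preserving_maps n"
    and "\<And>x. 1 \<le> x \<Longrightarrow> x \<le> n \<Longrightarrow> \<alpha> x = \<beta> x"
  shows "\<alpha> = \<beta>"
proof (rule PiE_ext)
  show "\<alpha> \<in> {1..n} \<rightarrow>\<^sub>E {1..n}" "\<beta> \<in> {1..n} \<rightarrow>\<^sub>E {1..n}"
    using assms(1,2) unfolding order_preserving_maps_def by blast+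
qed (use assms(3) in simp)

lemma order_preservingI:
  assumes "\<And>x. 1 \<le> x \<Longrightarrow> x \<le> n \<Longrightarrow> 1 \<le> \<alpha> x \<and> \<alpha> x \<le> n"
    and "\<alpha> \<in> extensional {1..n}"
    and "\<And>x. 1 \<le> x \<Longrightarrow> x < n \<Longrightarrow> \<alpha> x \<le> \<alpha> (Suc x)"
  shows "\<alpha> \<in> order_preserving_maps n"
proof -
  have "\<alpha> x \<le> \<alpha> y" if "1 \<le> x" "x \<le> y" "y \<le> n" for x y
    using that(2,3)
  proof (induction y rule: dec_induct)
    case (step y)
    then show ?case using assms(3)[of y] that(1) by simp
  qed simp
  then show ?thesis
    using assms(1,2) unfolding order_preserving_maps_def
    by (auto simp: mono_on_def PiE_def)
qed

lemma order_preserving_mult: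
  assumes "\<alpha> \<in> order_preserving_maps n" "\<beta> \<in> order_preserving_maps n"
  shows "map_mult n \<alpha> \<beta> \<in> order_preserving_maps n"
proof (rule order_preservingI)
  show "1 \<le> map_mult n \<alpha> \<beta> x \<and> map_mult n \<alpha> \<beta> x \<le> n" if "1 \<le> x" "x \<le> n" for x
    using that assms order_preserving_range[of _ n]
    by (metis atLeastAtMost_iff map_mult_apply)
  show "map_mult n \<alpha> \<beta> \<in> extensional {1..n}"
    unfolding map_mult_def by (rule compose_extensional)
  show "map_mult n \<alpha> \<beta> x \<le> map_mult n \<alpha> \<beta> (Suc x)" if "1 \<le> x" "x < n" for x
  proof -
    have "1 \<le> \<alpha> x" "\<alpha> (Suc x) \<le> n"
      using that order_preserving_range[OF assms(1), of x]
        order_preserving_range[OF assms(1), of "Suc x"] by auto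
    moreover have "\<alpha> x \<le> \<alpha> (Suc x)"
      using that order_preserving_mono[OF assms(1)] by simp
    ultimately show ?thesis
      using that order_preserving_mono[OF assms(2)] by (simp add: map_mult_apply)
  qed
qed

text \<open>Strict increase from a value at least \<open>a\<close> gives \<open>i \<le> \<alpha> i\<close>, and strict
increase up to a value at most \<open>n\<close> gives \<open>\<alpha> i \<le> i\<close>.\<close>

lemma order_preserving_fixes:
  assumes \<alpha>: "\<alpha> \<in> order_preserving_maps n" and a: "1 \<le> a" "a \<le> \<alpha> a"
    and strict: "\<forall>i\<in>{a..<n}. \<alpha> i < \<alpha> (Suc i)"
    and i: "a \<le> i" "i \<le> n"
  shows "\<alpha> i = i"
proof (rule antisym)
  show "i \<le> \<alpha> i" using i
  proof (induction i rule: dec_induct)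
    case (step j)
    then show ?case using bspec[OF strict, of j] a by simp
  qed (use a in simp)
  show "\<alpha> i \<le> i" using i(2,1)
  proof (induction i rule: inc_induct)
    case base
    then show ?case using order_preserving_range[OF \<alpha>, of n] a by auto
  next
    case (step j)
    then show ?case using bspec[OF strict, of j] a by simp
  qed
qed

lemma const_map_order_preserving: "k \<in> {1..n} \<Longrightarrow> const_map n k \<in> order_preserving_maps n"
  by (rule order_preservingI) (auto simp: const_map_def)

section \<open>Reversing the chain\<close>

definition flip :: "nat \<Rightarrow> (nat \<Rightarrow> nat) \<Rightarrow> nat \<Rightarrow> nat" where
  "flip n \<alpha> = (\<lambda>x\<in>{1..n}. n + 1 - \<alpha> (n + 1 - x))"

lemma flip_order_preserving:
  assumes "\<alpha> \<in> order_preserving_maps n"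
  shows "flip n \<alpha> \<in> order_preserving_maps n"
proof (rule order_preservingI)
  show "1 \<le> flip n \<alpha> x \<and> flip n \<alpha> x \<le> n" if "1 \<le> x" "x \<le> n" for x
  proof -
    have "\<alpha> (n + 1 - x) \<in> {1..n}"
      using that by (intro order_preserving_range[OF assms]) auto
    then show ?thesis using that by (auto simp: flip_def)
  qed
  show "flip n \<alpha> x \<le> flip n \<alpha> (Suc x)" if "1 \<le> x" "x < n" for x
    using order_preserving_mono[OF assms, of "n + 1 - Suc x" "n + 1 - x"] that
    by (simp add: flip_def diff_le_mono2)
qed (simp add: flip_def)

lemma flip_flip:
  assumes "\<alpha> \<in> order_preserving_maps n"
  shows "flip n (flip n \<alpha>) = \<alpha>"
proof (rule order_preserving_eqI)
  show "flip n (flip n \<alpha>) x = \<alpha> x" if "1 \<le> x" "x \<le> n" for x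
    using order_preserving_range[OF assms, of x] that by (auto simp: flip_def)
qed (use assms flip_order_preserving in auto)

lemma flip_mult:
  assumes "\<alpha> \<in> order_preserving_maps n" "\<beta> \<in> order_preserving_maps n"
  shows "flip n (map_mult n \<alpha> \<beta>) = map_mult n (flip n \<alpha>) (flip n \<beta>)"
proof (rule order_preserving_eqI)
  show "flip n (map_mult n \<alpha> \<beta>) x = map_mult n (flip n \<alpha>) (flip n \<beta>) x" if "1 \<le> x" "x \<le> n" for x
  proof -
    have mem: "n + 1 - x \<in> {1..n}" using that by auto
    then have "\<alpha> (n + 1 - x) \<in> {1..n}" by (rule order_preserving_range[OF assms(1)])
    then show ?thesis using that mem by (auto simp: flip_def map_mult_apply)
  qed
qed (use assms flip_order_preserving order_preserving_mult in auto)

lemma flip_const_map: "k \<in> {1..n} \<Longrightarrow> flip n (const_map n k) = const_map n (n + 1 - k)"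
  by (auto simp: flip_def const_map_def fun_eq_iff)

lemma flip_in_R_set:
  assumes k: "k \<in> {1..n}" and \<alpha>: "\<alpha> \<in> R_set n k"
  shows "flip n \<alpha> \<in> R_set n (n + 1 - k)"
proof -
  obtain \<gamma> where \<gamma>: "\<gamma> \<in> order_preserving_maps n" "\<gamma> \<noteq> const_map n k"
      "map_mult n \<gamma> \<alpha> = const_map n k"
    and \<alpha>O: "\<alpha> \<in> order_preserving_maps n"
    using \<alpha> unfolding R_set_def by auto
  have "map_mult n (flip n \<gamma>) (flip n \<alpha>) = const_map n (n + 1 - k)"
    using flip_mult[OF \<gamma>(1) \<alpha>O] \<gamma>(3) flip_const_map[OF k] by simp
  moreover have "flip n \<gamma> \<noteq> const_map n (n + 1 - k)"
    using \<gamma>(1,2) flip_flip const_map_order_preserving[OF k] flip_const_map[OF k] by metis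
  ultimately show ?thesis
    unfolding R_set_def using \<alpha>O \<gamma>(1) flip_order_preserving by blast
qed

lemma bij_betw_flip_R_set:
  assumes k: "k \<in> {1..n}"
  shows "bij_betw (flip n) (R_set n k) (R_set n (n + 1 - k))"
proof (rule bij_betw_byWitness[where f' = "flip n"])
  show "flip n ` R_set n k \<subseteq> R_set n (n + 1 - k)"
    using flip_in_R_set[OF k] by blast
  have "n + 1 - k \<in> {1..n}" "n + 1 - (n + 1 - k) = k" using k by auto
  then show "flip n ` R_set n (n + 1 - k) \<subseteq> R_set n k"
    using flip_in_R_set[of "n + 1 - k" n] by auto
qed (auto simp: R_set_def intro: flip_flip)

section \<open>The semigroup of maps collapsing 1 and 2 to 1\<close>

text \<open>A map \<open>\<gamma> \<noteq> \<pi>\<^sub>1\<close> has a value of at least 2, and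
\<open>\<gamma>\<alpha> = \<pi>\<^sub>1\<close> makes \<open>\<alpha>\<close> send it, and hence also 1 and 2, to 1.
Conversely, \<open>\<pi>\<^sub>2\<close> can serve as \<open>\<gamma>\<close>.\<close>

lemma R_set_one:
  assumes "n \<ge> 2"
  shows "R_set n 1 = {\<alpha> \<in> order_preserving_maps n. \<alpha> 1 = 1 \<and> \<alpha> 2 = 1}"
proof (intro equalityI subsetI)
  fix \<alpha> assume "\<alpha> \<in> R_set n 1"
  then obtain \<gamma> where \<gamma>: "\<gamma> \<in> order_preserving_maps n" "\<gamma> \<noteq> const_map n 1"
      "map_mult n \<gamma> \<alpha> = const_map n 1"
    and \<alpha>: "\<alpha> \<in> order_preserving_maps n"
    unfolding R_set_def by auto
  have one: "const_map n 1 \<in> order_preserving_maps n"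
    using assms by (intro const_map_order_preserving) auto
  obtain x where x: "1 \<le> x" "x \<le> n" "\<gamma> x \<noteq> const_map n 1 x"
    using order_preserving_eqI[OF \<gamma>(1) one] \<gamma>(2) by blast
  then have "2 \<le> \<gamma> x" "\<gamma> x \<le> n"
    using order_preserving_range[OF \<gamma>(1), of x] by (auto simp: const_map_def)
  moreover have "\<alpha> (\<gamma> x) = 1"
    using fun_cong[OF \<gamma>(3), of x] x by (simp add: map_mult_apply const_map_def)
  ultimately have "\<alpha> 1 \<le> 1" "\<alpha> 2 \<le> 1"
    using order_preserving_mono[OF \<alpha>, of 1 "\<gamma> x"] order_preserving_mono[OF \<alpha>, of 2 "\<gamma> x"] by auto
  then show "\<alpha> \<in> {\<alpha> \<in> order_preserving_maps n. \<alpha> 1 = 1 \<and> \<alpha> 2 = 1}"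
    using \<alpha> order_preserving_range[OF \<alpha>, of 1] order_preserving_range[OF \<alpha>, of 2] assms by auto
next
  fix \<alpha> assume \<alpha>: "\<alpha> \<in> {\<alpha> \<in> order_preserving_maps n. \<alpha> 1 = 1 \<and> \<alpha> 2 = 1}"
  have "const_map n 2 \<in> order_preserving_maps n"
    using assms by (intro const_map_order_preserving) auto
  moreover have "const_map n 2 1 \<noteq> const_map n 1 1"
    using assms by (simp add: const_map_def)
  then have "const_map n 2 \<noteq> const_map n 1" by metis
  moreover have "map_mult n (const_map n 2) \<alpha> = const_map n 1"
    using \<alpha> by (auto simp: map_mult_def compose_def const_map_def)
  ultimately show "\<alpha> \<in> R_set n 1"
    using \<alpha> unfolding R_set_def by blast
qed

text \<open>The simplifier writes 1 as \<open>Suc 0\<close>; in this form the characterisation can be used for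
rewriting.\<close>

lemma mem_R_set_one_iff:
  "n \<ge> 2 \<Longrightarrow> \<alpha> \<in> R_set n (Suc 0) \<longleftrightarrow> \<alpha> \<in> order_preserving_maps n \<and> \<alpha> 1 = 1 \<and> \<alpha> 2 = 1"
  using R_set_one[of n] by simp

lemma R_set_one_mult:
  assumes "n \<ge> 2" "\<alpha> \<in> R_set n 1" "\<beta> \<in> R_set n 1"
  shows "map_mult n \<alpha> \<beta> \<in> R_set n 1"
  using assms order_preserving_mult[of \<alpha> n \<beta>] by (simp add: mem_R_set_one_iff map_mult_apply)

text \<open>These are the maps of rank \<open>n - 1\<close> in \<open>R\<^sub>1\<close>: the kernel only identifies 1
with 2, and \<open>k\<close> is the point that the image omits. For \<open>k = 2\<close> the map is the left identity
of \<open>R\<^sub>1\<close>.\<close>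

definition lower_map :: "nat \<Rightarrow> nat \<Rightarrow> nat \<Rightarrow> nat" where
  "lower_map n k = (\<lambda>x\<in>{1..n}. if x \<le> k then max 1 (x - 1) else x)"

text \<open>Sending \<open>j\<close> and \<open>j + 1\<close> to \<open>j + 1\<close>, and not to \<open>j\<close>, is
essential. If both were sent to \<open>j\<close>, then in a product beginning with the map for \<open>j = n -
1\<close> the second factor would agree with the product at \<open>n - 1\<close>. A map that sends \<open>n -
1\<close> and \<open>n\<close> to \<open>n\<close> and coincides on no other neighbours than these and 1 and 2 would
then be its own second factor, and could not be built from other elements.\<close>

definition raise_map :: "nat \<Rightarrow> nat \<Rightarrow> nat \<Rightarrow> nat" where
  "raise_map n j = (\<lambda>x\<in>{1..n}. if x = 2 then 1 else if x = j then j + 1 else x)"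

lemma lower_map_in_R_set:
  assumes "k \<in> {2..n}"
  shows "lower_map n k \<in> R_set n 1"
proof -
  have "lower_map n k \<in> order_preserving_maps n"
    by (rule order_preservingI) (use assms in \<open>auto simp: lower_map_def\<close>)
  then show ?thesis using assms by (auto simp: mem_R_set_one_iff lower_map_def)
qed

lemma raise_map_in_R_set:
  assumes "j \<in> {3..<n}"
  shows "raise_map n j \<in> R_set n 1"
proof -
  have "raise_map n j \<in> order_preserving_maps n"
    by (rule order_preservingI) (use assms in \<open>auto simp: raise_map_def\<close>)
  then show ?thesis using assms by (auto simp: mem_R_set_one_iff raise_map_def)
qed

section \<open>Lower bound\<close>

text \<open>The range of \<open>i\<close> starts at 2, so that the coincidence of 1 with 2, shared by all of
\<open>R\<^sub>1\<close>, is left out.\<close>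

definition only_collapse :: "nat \<Rightarrow> nat \<Rightarrow> (nat \<Rightarrow> nat) set" where
  "only_collapse n j = {\<alpha> \<in> R_set n 1. \<forall>i\<in>{2..<n}. \<alpha> i = \<alpha> (Suc i) \<longleftrightarrow> i = j}"

text \<open>This rigidity is the core of the lower bound. Since \<open>\<gamma>\<close> sends 1 and 2 to 1, the first
factor must send 3 to at least 3, and an injective order-preserving map of \<open>{3..n}\<close> into itself is the
identity.\<close>

lemma injective_factor_is_left_identity:
  assumes n: "n \<ge> 3" and \<beta>: "\<beta> \<in> R_set n 1" and \<gamma>: "\<gamma> \<in> R_set n 1"
    and three: "map_mult n \<beta> \<gamma> 3 \<noteq> 1"
    and inj: "\<And>i. 3 \<le> i \<Longrightarrow> i < n \<Longrightarrow> \<beta> i \<noteq> \<beta> (Suc i)"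
  shows "\<beta> = lower_map n 2" "map_mult n \<beta> \<gamma> = \<gamma>"
proof -
  have \<beta>': "\<beta> \<in> order_preserving_maps n" "\<beta> 1 = 1" "\<beta> 2 = 1"
    and \<gamma>': "\<gamma> \<in> order_preserving_maps n" "\<gamma> 1 = 1" "\<gamma> 2 = 1"
    using \<beta> \<gamma> n by (auto simp: mem_R_set_one_iff)
  have "\<beta> 3 \<noteq> 1" "\<beta> 3 \<noteq> 2" using three \<gamma>' n by (auto simp: map_mult_apply)
  then have "3 \<le> \<beta> 3" using order_preserving_range[OF \<beta>'(1), of 3] n by auto
  moreover have "\<forall>i\<in>{3..<n}. \<beta> i < \<beta> (Suc i)"
  proof
    fix i assume "i \<in> {3..<n}"
    then show "\<beta> i < \<beta> (Suc i)"
      using inj[of i] order_preserving_mono[OF \<beta>'(1), of i "Suc i"] by simp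
  qed
  ultimately have fix3: "\<beta> i = i" if "3 \<le> i" "i \<le> n" for i
    using order_preserving_fixes[OF \<beta>'(1), of 3 i] that by auto
  have split: "x = 1 \<or> x = 2 \<or> 3 \<le> x" if "1 \<le> x" for x :: nat using that by auto
  have L: "lower_map n 2 \<in> order_preserving_maps n"
    using lower_map_in_R_set[of 2 n] n by (auto simp: mem_R_set_one_iff)
  show "\<beta> = lower_map n 2"
  proof (rule order_preserving_eqI[OF \<beta>'(1) L])
    show "\<beta> x = lower_map n 2 x" if "1 \<le> x" "x \<le> n" for x
      using split[OF that(1)] that fix3[of x] \<beta>'(2,3) by (auto simp: lower_map_def)
  qed
  show "map_mult n \<beta> \<gamma> = \<gamma>"
  proof (rule order_preserving_eqI[OF order_preserving_mult[OF \<beta>'(1) \<gamma>'(1)] \<gamma>'(1)])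
    show "map_mult n \<beta> \<gamma> x = \<gamma> x" if "1 \<le> x" "x \<le> n" for x
      using split[OF that(1)] that fix3[of x] \<beta>'(2,3) \<gamma>'(2,3) by (auto simp: map_mult_apply)
  qed
qed

text \<open>Injectivity of the product on \<open>{3..n}\<close> passes to the first factor, which is therefore the
left identity.\<close>

lemma lower_map_prime:
  assumes n: "n \<ge> 3" and k: "k \<in> {2..n}" and \<beta>: "\<beta> \<in> R_set n 1" and \<gamma>: "\<gamma> \<in> R_set n 1"
    and eq: "map_mult n \<beta> \<gamma> = lower_map n k"
  shows "\<gamma> = lower_map n k"
proof -
  have "map_mult n \<beta> \<gamma> 3 \<noteq> 1"
    unfolding eq using n by (auto simp: lower_map_def)
  moreover have "\<beta> i \<noteq> \<beta> (Suc i)" if "3 \<le> i" "i < n" for i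
  proof
    assume "\<beta> i = \<beta> (Suc i)"
    then have "lower_map n k i = lower_map n k (Suc i)"
      using that unfolding eq[symmetric] by (simp add: map_mult_apply)
    then show False using that by (auto simp: lower_map_def split: if_splits)
  qed
  ultimately show ?thesis
    using injective_factor_is_left_identity(2)[OF n \<beta> \<gamma>] eq by simp
qed

text \<open>The first factor coincides on neighbours only where the product does, that is at most at \<open>j\<close>.
If it does so at \<open>j\<close>, it has the required kernel; otherwise it is the left identity and the product
equals the second factor.\<close>

lemma only_collapse_prime:
  assumes n: "n \<ge> 3" and j: "j \<in> {3..<n}" and \<beta>: "\<beta> \<in> R_set n 1" and \<gamma>: "\<gamma> \<in> R_set n 1"
    and mem: "map_mult n \<beta> \<gamma> \<in> only_collapse n j"
  shows "\<beta> \<in> only_collapse n j \<or> \<gamma> \<in> only_collapse n j"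
proof (cases "\<beta> j = \<beta> (Suc j)")
  case True
  have "i = j" if "i \<in> {2..<n}" "\<beta> i = \<beta> (Suc i)" for i
    using mem that unfolding only_collapse_def by (auto simp: map_mult_apply)
  then show ?thesis using True \<beta> by (auto simp: only_collapse_def)
next
  case False
  have "\<beta> i \<noteq> \<beta> (Suc i)" if "3 \<le> i" "i < n" for i
    using mem that False unfolding only_collapse_def by (force simp: map_mult_apply)
  moreover have "2 \<in> {2..<n}" "2 \<noteq> j" using n j by auto
  then have "map_mult n \<beta> \<gamma> 2 \<noteq> map_mult n \<beta> \<gamma> (Suc 2)"
    using mem unfolding only_collapse_def by blast
  then have "map_mult n \<beta> \<gamma> 3 \<noteq> 1"
    using mem n unfolding only_collapse_def by (auto simp: mem_R_set_one_iff eval_nat_numeral)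
  ultimately show ?thesis
    using injective_factor_is_left_identity(2)[OF n \<beta> \<gamma>] mem by simp
qed

lemma lower_map_inj:
  assumes "k \<in> {2..n}" "l \<in> {2..n}" "lower_map n k = lower_map n l"
  shows "k = l"
proof (rule ccontr)
  have False if "k < l" "k \<in> {2..n}" "l \<in> {2..n}" "lower_map n k = lower_map n l" for k l
    using fun_cong[OF that(4), of l] that by (auto simp: lower_map_def)
  moreover assume "k \<noteq> l"
  ultimately show False using assms by (metis nat_neq_iff)
qed

lemma lower_map_notin_only_collapse:
  assumes "j \<in> {3..<n}"
  shows "lower_map n k \<notin> only_collapse n j"
proof
  assume "lower_map n k \<in> only_collapse n j"
  then have "lower_map n k j = lower_map n k (Suc j)"
    using assms by (auto simp: only_collapse_def)
  then show False using assms by (auto simp: lower_map_def split: if_splits)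
qed

lemma only_collapse_unique:
  assumes "\<alpha> \<in> only_collapse n i" "\<alpha> \<in> only_collapse n j" "i \<in> {3..<n}"
  shows "i = j"
proof -
  have "i \<in> {2..<n}" using assms(3) by auto
  then show ?thesis using assms(1,2) unfolding only_collapse_def by blast
qed

lemma raise_map_in_only_collapse:
  assumes "j \<in> {3..<n}"
  shows "raise_map n j \<in> only_collapse n j"
  using assms raise_map_in_R_set[OF assms] by (auto simp: only_collapse_def raise_map_def)

lemma card_generating_set_R_set_one:
  assumes n: "n \<ge> 3" and A: "A \<noteq> {}" "finite A" "A \<subseteq> R_set n 1"
    and gen: "generated_subsemigroup (map_mult n) (R_set n 1) A = R_set n 1"
  shows "2 * n - 4 \<le> card A"
proof -
  \<comment> \<open>the two families of prime sets, indexed by a disjoint union\<close>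
  define P where "P = case_sum (\<lambda>k. {lower_map n k}) (only_collapse n)"
  have "card ({2..n} <+> {3..<n}) \<le> card A"
  proof (rule card_generating_set_ge[where P = P, OF _ A(3,1) gen A(2)])
    show "P i \<inter> R_set n 1 \<noteq> {}" if "i \<in> {2..n} <+> {3..<n}" for i
      using that lower_map_in_R_set raise_map_in_only_collapse raise_map_in_R_set
      unfolding P_def by fastforce
    show "x \<in> P i \<or> y \<in> P i"
      if "i \<in> {2..n} <+> {3..<n}" "x \<in> R_set n 1" "y \<in> R_set n 1" "map_mult n x y \<in> P i" for i x y
      using that lower_map_prime[OF n] only_collapse_prime[OF n] unfolding P_def by fastforce
    show "P i \<inter> P j = {}"
      if "i \<in> {2..n} <+> {3..<n}" "j \<in> {2..n} <+> {3..<n}" "i \<noteq> j" for i j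
      using that lower_map_notin_only_collapse[of _ n]
      by (cases i; cases j) (auto simp: P_def dest: lower_map_inj only_collapse_unique)
  qed (use n R_set_one_mult in auto)
  then show ?thesis using n by (simp add: card_Plus)
qed

section \<open>Upper bound\<close>

definition lower_raise_maps :: "nat \<Rightarrow> (nat \<Rightarrow> nat) set" where
  "lower_raise_maps n = lower_map n ` {2..n} \<union> raise_map n ` {3..<n}"

text \<open>The first factor skips the point \<open>j\<close>, so the second may take any value there that keeps it
order-preserving. The preceding value is the choice that always makes progress.\<close>

lemma raise_map_factorization:
  assumes \<alpha>: "\<alpha> \<in> R_set n 1" and j: "j \<in> {3..<n}"
    and plateau: "\<alpha> (j - 1) < \<alpha> j" "\<alpha> j = \<alpha> (Suc j)"
  defines "\<gamma> \<equiv> \<alpha>(j := \<alpha> (j - 1))"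
  shows "\<gamma> \<in> R_set n 1" "map_mult n (raise_map n j) \<gamma> = \<alpha>" "sum \<gamma> {1..n} < sum \<alpha> {1..n}"
proof -
  have \<alpha>': "\<alpha> \<in> order_preserving_maps n" "\<alpha> 1 = 1" "\<alpha> 2 = 1"
    using \<alpha> j by (auto simp: mem_R_set_one_iff)
  have range: "1 \<le> \<alpha> x \<and> \<alpha> x \<le> n" if "1 \<le> x" "x \<le> n" for x
    using order_preserving_range[OF \<alpha>'(1), of x] that by auto
  have \<gamma>: "\<gamma> \<in> order_preserving_maps n"
  proof (rule order_preservingI)
    show "1 \<le> \<gamma> x \<and> \<gamma> x \<le> n" if "1 \<le> x" "x \<le> n" for x
      using range[of x] range[of "j - 1"] that j by (auto simp: \<gamma>_def)
    show "\<gamma> \<in> extensional {1..n}"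
      using j \<alpha>'(1) by (auto simp: \<gamma>_def order_preserving_maps_def PiE_def extensional_def)
    show "\<gamma> x \<le> \<gamma> (Suc x)" if "1 \<le> x" "x < n" for x
      using order_preserving_mono[OF \<alpha>'(1), of x "Suc x"] that j plateau by (auto simp: \<gamma>_def)
  qed
  then show \<gamma>R: "\<gamma> \<in> R_set n 1"
    using \<alpha>' j by (auto simp: mem_R_set_one_iff \<gamma>_def)
  show "map_mult n (raise_map n j) \<gamma> = \<alpha>"
  proof (rule order_preserving_eqI[OF _ \<alpha>'(1)])
    show "map_mult n (raise_map n j) \<gamma> \<in> order_preserving_maps n"
      using raise_map_in_R_set[OF j] \<gamma> order_preserving_mult by (auto simp: R_set_def)
    show "map_mult n (raise_map n j) \<gamma> x = \<alpha> x" if "1 \<le> x" "x \<le> n" for x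
      using that j plateau \<alpha>' by (auto simp: map_mult_apply raise_map_def \<gamma>_def)
  qed
  show "sum \<gamma> {1..n} < sum \<alpha> {1..n}"
    using plateau j by (intro sum_strict_mono_ex1) (auto simp: \<gamma>_def intro!: bexI[of _ j])
qed

text \<open>The image of the first factor omits \<open>k\<close>, so the second factor can be strictly increasing from
\<open>m - 1\<close> on only if some value that \<open>\<alpha>\<close> does not take is available at
\<open>k\<close>. There is one, as \<open>\<alpha>\<close> drops below the identity at \<open>m\<close>: if
\<open>k\<close> is the last point with \<open>\<alpha> k < k\<close>, then the value after \<open>\<alpha> k\<close>
is free. Moving the values of the points up to \<open>k\<close> one place to the left and filling the gap at
\<open>k\<close> gives the second factor. It need not lie in \<open>R\<^sub>1\<close>: for \<open>m = 2\<close> it is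
strictly increasing on the whole chain.\<close>

lemma lower_map_factorization:
  assumes n: "n \<ge> 3" and \<alpha>: "\<alpha> \<in> R_set n 1" and m: "2 \<le> m" "m \<le> n" "\<alpha> m = 1"
    and strict: "\<forall>i\<in>{m..<n}. \<alpha> i < \<alpha> (Suc i)"
  obtains k \<gamma> where "k \<in> {2..n}" "\<gamma> \<in> order_preserving_maps n" "map_mult n (lower_map n k) \<gamma> = \<alpha>"
    "\<gamma> 1 = 1" "\<gamma> (m - 1) = 1" "\<forall>i\<in>{m - 1..<n}. \<gamma> i < \<gamma> (Suc i)"
proof -
  have \<alpha>': "\<alpha> \<in> order_preserving_maps n" "\<alpha> 1 = 1" "\<alpha> 2 = 1"
    using \<alpha> n by (auto simp: mem_R_set_one_iff)
  have range: "1 \<le> \<alpha> x \<and> \<alpha> x \<le> n" if "1 \<le> x" "x \<le> n" for x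
    using order_preserving_range[OF \<alpha>'(1), of x] that by auto
  define K where "K = {k \<in> {m..n}. \<alpha> k < k}"
  define k where "k = Max K"
  have fin: "finite K" and "m \<in> K" using m by (auto simp: K_def)
  then have "k \<in> K" unfolding k_def using Max_in by blast
  then have k: "m \<le> k" "k \<le> n" "\<alpha> k < k" by (auto simp: K_def)
  have gap: "Suc (\<alpha> k) < \<alpha> (Suc k)" if "k < n"
  proof -
    have "Suc k \<notin> K" using Max_ge[OF fin, of "Suc k"] unfolding k_def by auto
    then show ?thesis using that k by (auto simp: K_def)
  qed
  define \<gamma> where "\<gamma> = (\<lambda>i\<in>{1..n}. if i < k then \<alpha> (Suc i) else if i = k then Suc (\<alpha> k) else \<alpha> i)"
  have \<gamma>: "\<gamma> \<in> order_preserving_maps n"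
  proof (rule order_preservingI)
    show "1 \<le> \<gamma> x \<and> \<gamma> x \<le> n" if "1 \<le> x" "x \<le> n" for x
      using range[of x] range[of "Suc x"] that k by (auto simp: \<gamma>_def)
    show "\<gamma> x \<le> \<gamma> (Suc x)" if "1 \<le> x" "x < n" for x
    proof -
      consider "Suc x < k" | "Suc x = k" | "x = k" | "k < x" by linarith
      then show ?thesis
        using order_preserving_mono[OF \<alpha>'(1), of x "Suc x"]
          order_preserving_mono[OF \<alpha>'(1), of "Suc x" "Suc (Suc x)"] that k gap
        by cases (auto simp: \<gamma>_def)
    qed
  qed (simp add: \<gamma>_def)
  show ?thesis
  proof
    show "k \<in> {2..n}" using k m by auto
    show "map_mult n (lower_map n k) \<gamma> = \<alpha>"
    proof (rule order_preserving_eqI[OF _ \<alpha>'(1)])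
      show "map_mult n (lower_map n k) \<gamma> \<in> order_preserving_maps n"
        using lower_map_in_R_set[OF \<open>k \<in> {2..n}\<close>] \<gamma> order_preserving_mult by (auto simp: R_set_def)
      show "map_mult n (lower_map n k) \<gamma> x = \<alpha> x" if "1 \<le> x" "x \<le> n" for x
      proof (cases "x = 1")
        case True
        then show ?thesis
          using that k m \<alpha>' by (auto simp: map_mult_apply lower_map_def \<gamma>_def eval_nat_numeral)
      next
        case False
        then have "max 1 (x - 1) = x - 1" "Suc (x - 1) = x" using that by auto
        then show ?thesis
          using that False k m by (auto simp: map_mult_apply lower_map_def \<gamma>_def)
      qed
    qed
    show "\<gamma> 1 = 1"
      using k m \<alpha>' by (auto simp: \<gamma>_def eval_nat_numeral)
    show "\<gamma> (m - 1) = 1"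
      using k m by (auto simp: \<gamma>_def)
    show "\<forall>i\<in>{m - 1..<n}. \<gamma> i < \<gamma> (Suc i)"
    proof
      fix i assume i: "i \<in> {m - 1..<n}"
      consider "Suc i < k" | "Suc i = k" | "i = k" | "k < i" by linarith
      then show "\<gamma> i < \<gamma> (Suc i)"
        using bspec[OF strict, of i] bspec[OF strict, of "Suc i"] i k m gap by cases (auto simp: \<gamma>_def)
    qed
  qed (fact \<gamma>)
qed

text \<open>Induction on \<open>m\<close>: for \<open>m = 2\<close> the second factor of the factorization is the
identity, so the map is itself one of the generators; for larger \<open>m\<close> the second factor lies in
\<open>R\<^sub>1\<close> and has a smaller \<open>m\<close>.\<close>

lemma generates_strict:
  assumes n: "n \<ge> 3" and T: "subsemigroup (map_mult n) (R_set n 1) T" "lower_map n ` {2..n} \<subseteq> T"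
    and m: "2 \<le> m" "m \<le> n" and \<alpha>: "\<alpha> \<in> R_set n 1" "\<alpha> m = 1"
    and strict: "\<forall>i\<in>{m..<n}. \<alpha> i < \<alpha> (Suc i)"
  shows "\<alpha> \<in> T"
  using m \<alpha> strict
proof (induction m arbitrary: \<alpha> rule: dec_induct)
  case base
  obtain k \<gamma> where k: "k \<in> {2..n}" and \<gamma>: "\<gamma> \<in> order_preserving_maps n"
    and eq: "map_mult n (lower_map n k) \<gamma> = \<alpha>" and one: "\<gamma> 1 = 1"
    and inc: "\<forall>i\<in>{2 - 1..<n}. \<gamma> i < \<gamma> (Suc i)"
    using lower_map_factorization[OF n base(2) order.refl base(1,3,4)] by blast
  have id: "\<gamma> i = i" if "1 \<le> i" "i \<le> n" for i
    using order_preserving_fixes[OF \<gamma>, of 1 i] one inc that by auto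
  have L: "lower_map n k \<in> order_preserving_maps n"
    using lower_map_in_R_set[OF k] by (auto simp: R_set_def)
  have "map_mult n (lower_map n k) \<gamma> = lower_map n k"
  proof (rule order_preserving_eqI[OF order_preserving_mult[OF L \<gamma>] L])
    show "map_mult n (lower_map n k) \<gamma> x = lower_map n k x" if "1 \<le> x" "x \<le> n" for x
      using that order_preserving_range[OF L, of x] id by (auto simp: map_mult_apply)
  qed
  then show ?case using T(2) k eq by auto
next
  case (step m)
  have m2: "2 \<le> Suc m" using step by simp
  obtain k \<gamma> where k: "k \<in> {2..n}" and \<gamma>: "\<gamma> \<in> order_preserving_maps n"
    and eq: "map_mult n (lower_map n k) \<gamma> = \<alpha>" and one: "\<gamma> 1 = 1" "\<gamma> (Suc m - 1) = 1"
    and inc: "\<forall>i\<in>{Suc m - 1..<n}. \<gamma> i < \<gamma> (Suc i)"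
    using lower_map_factorization[OF n step.prems(2) m2 step.prems(1,3,4)] by blast
  have "\<gamma> 2 = 1"
    using order_preserving_mono[OF \<gamma>, of 1 2] order_preserving_mono[OF \<gamma>, of 2 m] one step
    by auto
  then have "\<gamma> \<in> R_set n 1" using \<gamma> one n by (auto simp: mem_R_set_one_iff)
  then have "\<gamma> \<in> T" using step.IH[of \<gamma>] step.prems one inc by auto
  then show ?case using T k eq unfolding subsemigroup_def by blast
qed

text \<open>Induction on the sum of the values. Once no plateau can be lowered any more, the map increases strictly
after the last point that it sends to 1.\<close>

lemma lower_raise_maps_generate:
  assumes n: "n \<ge> 3" and T: "subsemigroup (map_mult n) (R_set n 1) T" "lower_raise_maps n \<subseteq> T"
    and \<alpha>: "\<alpha> \<in> R_set n 1"
  shows "\<alpha> \<in> T"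
  using \<alpha>
proof (induction "sum \<alpha> {1..n}" arbitrary: \<alpha> rule: less_induct)
  case less
  show ?case
  proof (cases "\<exists>j\<in>{3..<n}. \<alpha> (j - 1) < \<alpha> j \<and> \<alpha> j = \<alpha> (Suc j)")
    case True
    then obtain j where j: "j \<in> {3..<n}" "\<alpha> (j - 1) < \<alpha> j" "\<alpha> j = \<alpha> (Suc j)" by blast
    note fac = raise_map_factorization[OF less.prems j]
    have "\<alpha>(j := \<alpha> (j - 1)) \<in> T" using less.hyps fac by blast
    moreover have "raise_map n j \<in> T" using T j by (auto simp: lower_raise_maps_def)
    ultimately show ?thesis using T(1) fac(2) unfolding subsemigroup_def by metis
  next
    case False
    have \<alpha>': "\<alpha> \<in> order_preserving_maps n" "\<alpha> 1 = 1" "\<alpha> 2 = 1"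
      using less.prems n by (auto simp: mem_R_set_one_iff)
    define M where "M = {i \<in> {1..n}. \<alpha> i = 1}"
    define m where "m = Max M"
    have fin: "finite M" and two: "2 \<in> M" using n \<alpha>' by (auto simp: M_def)
    then have "m \<in> M" unfolding m_def using Max_in by blast
    moreover have "2 \<le> m" unfolding m_def using Max_ge[OF fin two] .
    ultimately have m: "2 \<le> m" "m \<le> n" "\<alpha> m = 1" by (auto simp: M_def)
    \<comment> \<open>a first plateau after \<open>m\<close> would be preceded by a strict rise, and could be lowered\<close>
    have "i < n \<longrightarrow> \<alpha> i < \<alpha> (Suc i)" if "m \<le> i" for i
      using that
    proof (induction i rule: dec_induct)
      case base
      have "Suc m \<notin> M" using Max_ge[OF fin, of "Suc m"] unfolding m_def by auto
      then show ?case
        using order_preserving_range[OF \<alpha>'(1), of "Suc m"] m by (auto simp: M_def)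
    next
      case (step i)
      show ?case
      proof
        assume i: "Suc i < n"
        then have "\<alpha> (Suc i) \<noteq> \<alpha> (Suc (Suc i))"
          using False[simplified bex_simps, rule_format] step m
          by (auto dest!: bspec[of _ _ "Suc i"])
        then show "\<alpha> (Suc i) < \<alpha> (Suc (Suc i))"
          using order_preserving_mono[OF \<alpha>'(1), of "Suc i" "Suc (Suc i)"] i by simp
      qed
    qed
    then show ?thesis
      using generates_strict[OF n T(1) _ m(1,2) less.prems m(3)] T(2)
      by (auto simp: lower_raise_maps_def)
  qed
qed

lemma card_lower_raise_maps: "n \<ge> 3 \<Longrightarrow> card (lower_raise_maps n) \<le> 2 * n - 4"
  using card_Un_le[of "lower_map n ` {2..n}" "raise_map n ` {3..<n}"]
    card_image_le[of "{2..n}" "lower_map n"] card_image_le[of "{3..<n}" "raise_map n"]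
  by (simp add: lower_raise_maps_def)

lemma rank_R_set_one:
  assumes n: "n \<ge> 3"
  shows "semigroup_rank (map_mult n) (R_set n 1) = 2 * n - 4"
proof (rule semigroup_rank_eqI)
  show ne: "lower_raise_maps n \<noteq> {}" using n by (simp add: lower_raise_maps_def)
  show "finite (lower_raise_maps n)" by (simp add: lower_raise_maps_def)
  show sub: "lower_raise_maps n \<subseteq> R_set n 1"
    using lower_map_in_R_set raise_map_in_R_set by (auto simp: lower_raise_maps_def)
  have "T = R_set n 1" if "subsemigroup (map_mult n) (R_set n 1) T" "lower_raise_maps n \<subseteq> T" for T
    using lower_raise_maps_generate[OF n that] that(1) unfolding subsemigroup_def by blast
  then show "generated_subsemigroup (map_mult n) (R_set n 1) (lower_raise_maps n) = R_set n 1"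
    using generates_iff[OF _ sub ne, of "map_mult n"] R_set_one_mult n by auto
  show "card (lower_raise_maps n) \<le> 2 * n - 4" using n by (rule card_lower_raise_maps)
qed (rule card_generating_set_R_set_one[OF n])

theorem theorem11:
  fixes n :: nat
  assumes "n \<ge> 3"
  shows "semigroup_rank (map_mult n) (R_set n 1) = 2 * n - 4
       \<and> semigroup_rank (map_mult n) (R_set n n) = 2 * n - 4"
proof
  show one: "semigroup_rank (map_mult n) (R_set n 1) = 2 * n - 4"
    using assms by (rule rank_R_set_one)
  have "semigroup_rank (map_mult n) (R_set n 1) = semigroup_rank (map_mult n) (R_set n n)"
  proof (rule semigroup_rank_iso[where f = "flip n"])
    show "bij_betw (flip n) (R_set n 1) (R_set n n)"
      using bij_betw_flip_R_set[of 1 n] assms by simp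
    show "flip n (map_mult n x y) = map_mult n (flip n x) (flip n y)"
      if "x \<in> R_set n 1" "y \<in> R_set n 1" for x y
      using that by (intro flip_mult) (auto simp: R_set_def)
  qed (use assms R_set_one_mult in auto)
  then show "semigroup_rank (map_mult n) (R_set n n) = 2 * n - 4" using one by simp
qed

end
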